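(* For every constant $c$ there is a constant $\gamma\in(0,1/2)$ such that the following holds. Let $P=(P_n)_{n\in\mathbb{N}}$ be any Boolean communication problem, with $P_n\colon\{0,1\}^n\times\{0,1\}^n\to\{0,1\}$, whose public-coin randomized communication complexity (with error probability at most $1/3$) is at most $c$ for all $n$. Then $P$ can be solved by a single query to $\textsc{GapHD}_\gamma$: for every $n$ there exist $L\in\mathbb{N}$ and maps $\Phi,\Psi\colon\{0,1\}^n\to\{0,1\}^L$ such that for all $x,y\in\{0,1\}^n$, $\textsc{GapHD}_\gamma(\Phi(x),\Psi(y))$ is defined (not $*$) and equals $P_n(x,y)$.
   Context: For $L\in\mathbb{N}$ and $\gamma\in(0,1/2)$, the partial function $\textsc{GapHD}_\gamma$ on $u,v\in\{0,1\}^L$ is $1$ if $\mathrm{dist}(u,v)\le\gamma L$, $0$ if $\mathrm{dist}(u,v)\ge(1-\gamma)L$, and $*$ (undefined) otherwise, where $\mathrm{dist}$ is Hamming distance. *)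

theory Defs
  imports "HOL-Probability.Probability"
begin

definition cube :: "nat \<Rightarrow> bool list set" where
  "cube n = {x. length x = n}"

definition hamming_dist :: "'a list \<Rightarrow> 'a list \<Rightarrow> nat" where
  "hamming_dist u v = card {i. i < length u \<and> u ! i \<noteq> v ! i}"

text \<open>
  The partial function \<open>GapHD\<close> on \<open>cube L\<close>, with \<^term>\<open>None\<close> for undefined. For \<open>0 < L\<close> and
  \<open>\<gamma> < 1/2\<close> the two defined cases exclude each other; for \<open>L = 0\<close> they overlap, so users of this
  function should require \<open>0 < L\<close>.
\<close>
definition gap_hd :: "real \<Rightarrow> nat \<Rightarrow> bool list \<Rightarrow> bool list \<Rightarrow> bool option" where
  "gap_hd \<gamma> L u v =
     (if real (hamming_dist u v) \<le> \<gamma> * real L then Some True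
      else if real (hamming_dist u v) \<ge> (1 - \<gamma>) * real L then Some False
      else None)"

text \<open>
  Deterministic two-party protocol trees. At an inner node the owner sends one bit, computed from
  their own input; the first subtree is taken if the bit is \<^term>\<open>True\<close>. The output is the label
  of the leaf reached.
\<close>
datatype ('x, 'y) protocol =
    Output bool
  | Alice "'x \<Rightarrow> bool" "('x, 'y) protocol" "('x, 'y) protocol"
  | Bob "'y \<Rightarrow> bool" "('x, 'y) protocol" "('x, 'y) protocol"

primrec run :: "('x, 'y) protocol \<Rightarrow> 'x \<Rightarrow> 'y \<Rightarrow> bool" where
  "run (Output b) x y = b"
| "run (Alice a p q) x y = (if a x then run p x y else run q x y)"
| "run (Bob b p q) x y = (if b y then run p x y else run q x y)"

primrec cost :: "('x, 'y) protocol \<Rightarrow> nat" where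
  "cost (Output b) = 0"
| "cost (Alice a p q) = Suc (max (cost p) (cost q))"
| "cost (Bob b p q) = Suc (max (cost p) (cost q))"

text \<open>
  A public-coin protocol is a probability distribution over deterministic protocols; its cost is
  the largest cost over the support, and it must err with probability at most \<open>\<epsilon>\<close> on every
  input pair. Discrete distributions suffice: on finite input sets there are only finitely many
  essentially different deterministic protocols of bounded cost.
\<close>
definition pub_computes ::
  "real \<Rightarrow> 'x set \<Rightarrow> 'y set \<Rightarrow> ('x \<Rightarrow> 'y \<Rightarrow> bool) \<Rightarrow> ('x, 'y) protocol pmf \<Rightarrow> bool" where
  "pub_computes \<epsilon> X Y f R \<longleftrightarrow>
     (\<forall>x\<in>X. \<forall>y\<in>Y. measure_pmf.prob R {p. run p x y \<noteq> f x y} \<le> \<epsilon>)"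

definition pub_cc :: "real \<Rightarrow> 'x set \<Rightarrow> 'y set \<Rightarrow> ('x \<Rightarrow> 'y \<Rightarrow> bool) \<Rightarrow> nat" where
  "pub_cc \<epsilon> X Y f =
     (LEAST k. \<exists>R. pub_computes \<epsilon> X Y f R \<and> (\<forall>p\<in>set_pmf R. cost p \<le> k))"

text \<open>
  The minimum in \<^const>\<open>pub_cc\<close> is over a nonempty set for inputs from \<open>cube n\<close>: Alice can send
  her whole input, after which Bob announces the answer.
\<close>
lemma ex_protocol_take:
  "\<exists>p::(bool list, 'y) protocol. \<forall>x y. k \<le> length x \<longrightarrow> run p x y = f (take k x) y"
proof (induction k arbitrary: f)
  case 0
  have "\<forall>x y. run (Bob (f []) (Output True) (Output False)) x y = f (take 0 x) y"
    by simp
  then show ?case by blast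
next
  case (Suc k)
  obtain p q :: "(bool list, 'y) protocol" where
    p: "\<forall>x y. k \<le> length x \<longrightarrow> run p x y = f (take k x @ [True]) y" and
    q: "\<forall>x y. k \<le> length x \<longrightarrow> run q x y = f (take k x @ [False]) y"
    using Suc.IH[of "\<lambda>z. f (z @ [True])"] Suc.IH[of "\<lambda>z. f (z @ [False])"] by fast
  have "run (Alice (\<lambda>x. x ! k) p q) x y = f (take (Suc k) x) y" if "Suc k \<le> length x" for x y
    using that p q by (cases "x ! k") (simp_all add: take_Suc_conv_app_nth)
  then show ?case by (intro exI[of _ "Alice (\<lambda>x. x ! k) p q"]) simp
qed

lemma ex_pub_computes_cube:
  fixes Y :: "'y set"
  assumes "0 \<le> \<epsilon>"
  shows "\<exists>k R. pub_computes \<epsilon> (cube n) Y f R \<and> (\<forall>p\<in>set_pmf R. cost p \<le> k)"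
proof -
  obtain p :: "(bool list, 'y) protocol"
    where p: "\<forall>x y. n \<le> length x \<longrightarrow> run p x y = f (take n x) y"
    using ex_protocol_take[of n f] by (elim exE)
  have "pub_computes \<epsilon> (cube n) Y f (return_pmf p)"
    using assms p by (simp add: pub_computes_def cube_def)
  moreover have "\<forall>p'\<in>set_pmf (return_pmf p). cost p' \<le> cost p" by simp
  ultimately show ?thesis by (intro exI conjI)
qed

end

theory Submission
  imports Defs
begin

text \<open>
  For \<open>\<plusminus>1\<close> strings, distance and inner product determine each other, so it suffices to realise the
  output sign of a protocol as an inner product that is not too small. A deterministic protocol of
  cost at most \<open>k\<close> has codes of length \<open>4 ^ k\<close> with inner product exactly \<open>2 ^ k\<close> times the output
  sign: at an inner node the speaker doubles the code of the chosen subtree and cancels the code of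
  the other subtree against its negation. For a randomized protocol, concatenate the codes over a
  sufficiently fine sample of its deterministic protocols; an error fraction of at most
  \<open>1/3 + 1/15 = 2/5\<close> leaves an inner product of at least a fraction \<open>1 / (5 * 2 ^ k)\<close> of the length.
\<close>

section \<open>Inner products of sign strings and Hamming distance\<close>

definition correlation :: "bool list \<Rightarrow> bool list \<Rightarrow> int" where
  "correlation u v = (\<Sum>(a, b)\<leftarrow>zip u v. if a = b then 1 else -1)"

definition bool_sign :: "bool \<Rightarrow> int" where
  "bool_sign b = (if b then 1 else -1)"

lemma correlation_append [simp]:
  "length u = length v \<Longrightarrow> correlation (u @ u') (v @ v') = correlation u v + correlation u' v'"
  by (simp add: correlation_def)

lemma correlation_map_Not_left [simp]:
  "length u = length v \<Longrightarrow> correlation (map Not u) v = - correlation u v"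
  by (induction u v rule: list_induct2) (auto simp: correlation_def)

lemma correlation_map_Not_right [simp]:
  "length u = length v \<Longrightarrow> correlation u (map Not v) = - correlation u v"
  by (induction u v rule: list_induct2) (auto simp: correlation_def)

lemma hamming_dist_conv_filter:
  assumes "length u = length v"
  shows "hamming_dist u v = length (filter (\<lambda>(a, b). a \<noteq> b) (zip u v))"
  using assms unfolding hamming_dist_def length_filter_conv_card
  by (intro arg_cong[where f = card]) auto

text \<open>An agreeing position adds 1 to the correlation and a differing one -1, so the
  correlation is the length minus twice the number of differences.\<close>

lemma hamming_dist_conv_correlation:
  assumes "length u = length v"
  shows "2 * int (hamming_dist u v) = int (length u) - correlation u v"
  unfolding hamming_dist_conv_filter[OF assms] using assms
  by (induction u v rule: list_induct2) (auto simp: correlation_def)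

section \<open>Codes for deterministic protocols\<close>

text \<open>Length and scale depend on \<open>k\<close> alone, not on the cost of \<open>p\<close>,
  so that codes of different protocols get equal weight when concatenated.\<close>

definition encodes ::
  "nat \<Rightarrow> ('x, 'y) protocol \<Rightarrow> ('x \<Rightarrow> bool list) \<Rightarrow> ('y \<Rightarrow> bool list) \<Rightarrow> bool" where
  "encodes k p U V \<longleftrightarrow> (\<forall>x y. length (U x) = 4 ^ k \<and> length (V y) = 4 ^ k \<and>
     correlation (U x) (V y) = 2 ^ k * bool_sign (run p x y))"

text \<open>Bob's string must not depend on \<open>a x\<close>, so he repeats both of his codes.
  Against it, the two equal copies of the chosen code add up, and the other code meets its negation
  and contributes 0. Length grows by 4, correlation by 2.\<close>

lemma encodes_Alice:
  assumes "encodes k p U V" "encodes k q U' V'"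
  shows "encodes (Suc k) (Alice a p q)
    (\<lambda>x. if a x then U x @ U x @ U' x @ map Not (U' x) else U x @ map Not (U x) @ U' x @ U' x)
    (\<lambda>y. V y @ V y @ V' y @ V' y)"
  using assms by (auto simp: encodes_def)

lemma encodes_Bob:
  assumes "encodes k p U V" "encodes k q U' V'"
  shows "encodes (Suc k) (Bob b p q)
    (\<lambda>x. U x @ U x @ U' x @ U' x)
    (\<lambda>y. if b y then V y @ V y @ V' y @ map Not (V' y) else V y @ map Not (V y) @ V' y @ V' y)"
  using assms by (auto simp: encodes_def)

text \<open>Leaves lie at different depths, so a leaf needs a code at every level
  \<open>k\<close>.\<close>

lemma ex_encodes_Output:
  "\<exists>(U :: 'x \<Rightarrow> bool list) (V :: 'y \<Rightarrow> bool list). encodes k (Output b) U V"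
proof (induction k)
  case 0
  have "encodes 0 (Output b) (\<lambda>_. [b]) (\<lambda>_. [True])"
    by (simp add: encodes_def correlation_def bool_sign_def)
  then show ?case by blast
next
  case (Suc k)
  then obtain U :: "'x \<Rightarrow> bool list" and V :: "'y \<Rightarrow> bool list"
    where "encodes k (Output b) U V" by blast
  \<comment> \<open>Three blocks count positively and one negatively, giving the required factor
    2.\<close>
  then have "encodes (Suc k) (Output b) (\<lambda>x. U x @ U x @ U x @ map Not (U x)) (\<lambda>y. V y @ V y @ V y @ V y)"
    by (auto simp: encodes_def)
  then show ?case by blast
qed

lemma ex_encodes:
  "cost p \<le> k \<Longrightarrow> \<exists>U V. encodes k p U V"
proof (induction p arbitrary: k)
  case (Output b)
  then show ?case using ex_encodes_Output by blast
next
  case (Alice a p q)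
  then obtain k' where k: "k = Suc k'" "cost p \<le> k'" "cost q \<le> k'"
    by (cases k) auto
  from Alice.IH(1)[OF k(2)] Alice.IH(2)[OF k(3)] show ?case
    unfolding k(1) using encodes_Alice by blast
next
  case (Bob b p q)
  then obtain k' where k: "k = Suc k'" "cost p \<le> k'" "cost q \<le> k'"
    by (cases k) auto
  from Bob.IH(1)[OF k(2)] Bob.IH(2)[OF k(3)] show ?case
    unfolding k(1) using encodes_Bob by blast
qed

section \<open>Finite samples with small error, and sums over them\<close>

lemma length_filter_concat_replicate:
  "distinct l \<Longrightarrow> length (filter P (concat (map (\<lambda>t. replicate (m t) t) l))) = sum m {t \<in> set l. P t}"
proof (induction l)
  case (Cons t l)
  have "{s \<in> set (t # l). P s} = (if P t then insert t {s \<in> set l. P s} else {s \<in> set l. P s})"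
    by auto
  with Cons show ?case by auto
qed simp

text \<open>Take each \<open>t\<close> with its weight times \<open>N\<close>, rounded down. No
  event is then counted more than \<open>N\<close> times its probability, and rounding shortens the
  list by at most 1 per point of the support. The same list works for all events.\<close>

lemma ex_sample_list:
  fixes Q :: "'a pmf"
  assumes fin: "finite (set_pmf Q)" and "0 < \<epsilon>"
  shows "\<exists>xs. xs \<noteq> [] \<and> set xs \<subseteq> set_pmf Q \<and>
    (\<forall>A. real (length (filter (\<lambda>x. x \<in> A) xs)) \<le> (measure_pmf.prob Q A + \<epsilon>) * real (length xs))"
proof -
  define K where "K = card (set_pmf Q)"
  \<comment> \<open>Chosen so that \<open>N * p \<le> (p + \<epsilon>) * (N - K)\<close> for every
    probability \<open>p \<le> 1\<close>.\<close>
  obtain N :: nat where N: "real K * (1 + \<epsilon>) / \<epsilon> < real N"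
    using reals_Archimedean2 by blast
  define m where "m t = nat \<lfloor>real N * pmf Q t\<rfloor>" for t
  obtain l where l: "set l = set_pmf Q" "distinct l"
    using finite_distinct_list[OF fin] by blast
  define xs where "xs = concat (map (\<lambda>t. replicate (m t) t) l)"
  have count: "length (filter P xs) = sum m {t \<in> set_pmf Q. P t}" for P
    unfolding xs_def using length_filter_concat_replicate[OF l(2), of P m] l(1) by simp
  have upper: "real (m t) \<le> real N * pmf Q t" for t
    unfolding m_def by (simp add: of_nat_floor)
  have lower: "real N * pmf Q t - 1 \<le> real (m t)" for t
    unfolding m_def by linarith
  have "real N - real K = (\<Sum>t\<in>set_pmf Q. real N * pmf Q t - 1)"
    using sum_pmf_eq_1[OF fin]
    by (simp add: sum_subtractf K_def flip: sum_distrib_left)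
  also have "\<dots> \<le> (\<Sum>t\<in>set_pmf Q. real (m t))"
    by (intro sum_mono lower)
  also have "\<dots> = real (length xs)"
    using count[of "\<lambda>_. True"] by simp
  finally have len: "real N - real K \<le> real (length xs)" .
  have N': "real K * (1 + \<epsilon>) < \<epsilon> * real N"
    using N \<open>0 < \<epsilon>\<close> by (simp add: field_simps)
  have "\<epsilon> * real K \<le> real K * (1 + \<epsilon>)"
    by (simp add: algebra_simps)
  with N' have "\<epsilon> * real K < \<epsilon> * real N" by linarith
  then have "real K < real N" using \<open>0 < \<epsilon>\<close> by simp
  with len have "xs \<noteq> []" by auto
  moreover have "set xs \<subseteq> set_pmf Q"
    unfolding l(1)[symmetric] by (auto simp: xs_def split: if_splits)
  moreover have "real (length (filter (\<lambda>x. x \<in> A) xs)) \<le> (measure_pmf.prob Q A + \<epsilon>) * real (length xs)"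
    for A
  proof -
    let ?p = "measure_pmf.prob Q A"
    have "real (length (filter (\<lambda>x. x \<in> A) xs)) = (\<Sum>t\<in>{t \<in> set_pmf Q. t \<in> A}. real (m t))"
      by (simp add: count)
    also have "\<dots> \<le> (\<Sum>t\<in>{t \<in> set_pmf Q. t \<in> A}. real N * pmf Q t)"
      by (intro sum_mono upper)
    also have "\<dots> = real N * measure_pmf.prob Q {t \<in> set_pmf Q. t \<in> A}"
      using fin by (simp add: measure_measure_pmf_finite sum_distrib_left)
    also have "measure_pmf.prob Q {t \<in> set_pmf Q. t \<in> A} = ?p"
      using measure_Int_set_pmf[of Q A] by (simp add: Collect_conj_eq Int_commute)
    also have "real N * ?p \<le> (?p + \<epsilon>) * (real N - real K)"
    proof -
      have "real K * ?p \<le> real K * 1"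
        by (intro mult_left_mono) auto
      with N' show ?thesis by (simp add: algebra_simps)
    qed
    also have "\<dots> \<le> (?p + \<epsilon>) * real (length xs)"
      using len \<open>0 < \<epsilon>\<close> by (intro mult_left_mono) auto
    finally show ?thesis .
  qed
  ultimately show ?thesis by blast
qed

lemma correlation_concat:
  assumes "\<And>t. t \<in> set ts \<Longrightarrow> length (u t) = length (v t)"
  shows "correlation (concat (map u ts)) (concat (map v ts)) = (\<Sum>t\<leftarrow>ts. correlation (u t) (v t))"
  using assms by (induction ts) (auto simp: correlation_def)

lemma length_concat_const:
  assumes "\<And>t. t \<in> set ts \<Longrightarrow> length (u t) = l"
  shows "length (concat (map u ts)) = length ts * l"
  using assms by (induction ts) auto

lemma sum_list_bool_sign:
  "(\<Sum>t\<leftarrow>ts. bool_sign (g t)) =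
     bool_sign b * (int (length ts) - 2 * int (length (filter (\<lambda>t. g t \<noteq> b) ts)))"
  by (induction ts) (auto simp: bool_sign_def algebra_simps)

text \<open>One list serves all input pairs, since the sampling bound holds for all events at once;
  the pair \<open>(x, y)\<close> uses the event of erring there. Drawing from the support of
  \<open>R\<close> preserves any cost bound.\<close>

lemma ex_protocol_sample:
  fixes f :: "'x \<Rightarrow> 'y \<Rightarrow> bool"
  assumes "finite X" "finite Y" and R: "pub_computes \<delta> X Y f R" and "0 < \<epsilon>"
  shows "\<exists>ps. ps \<noteq> [] \<and> set ps \<subseteq> set_pmf R \<and>
    (\<forall>x\<in>X. \<forall>y\<in>Y.
       real (length (filter (\<lambda>p. run p x y \<noteq> f x y) ps)) \<le> (\<delta> + \<epsilon>) * real (length ps))"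
proof -
  \<comment> \<open>The support of \<open>R\<close> may be infinite; the behaviours on \<open>X \<times> Y\<close> are finite in number.\<close>
  define M where "M p = {(x, y) \<in> X \<times> Y. run p x y}" for p :: "('x, 'y) protocol"
  have "set_pmf (map_pmf M R) \<subseteq> Pow (X \<times> Y)"
    by (auto simp: M_def)
  then have "finite (set_pmf (map_pmf M R))"
    by (rule finite_subset) (use assms in auto)
  from ex_sample_list[OF this \<open>0 < \<epsilon>\<close>] obtain ts where ts: "ts \<noteq> []" "set ts \<subseteq> M ` set_pmf R"
    and bound: "\<And>A. real (length (filter (\<lambda>t. t \<in> A) ts))
      \<le> (measure_pmf.prob (map_pmf M R) A + \<epsilon>) * real (length ts)"
    by auto
  \<comment> \<open>Each sampled behaviour is turned back into a protocol in the support that has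
    it.\<close>
  define r where "r = inv_into (set_pmf R) M"
  have r: "r t \<in> set_pmf R" "M (r t) = t" if "t \<in> set ts" for t
    using that ts(2) inv_into_into[of t M "set_pmf R"] f_inv_into_f[of t M "set_pmf R"]
    unfolding r_def by (simp_all add: subset_iff)
  have "real (length (filter (\<lambda>p. run p x y \<noteq> f x y) (map r ts))) \<le> (\<delta> + \<epsilon>) * real (length (map r ts))"
    if xy: "x \<in> X" "y \<in> Y" for x y
  proof -
    let ?A = "{t. ((x, y) \<in> t) \<noteq> f x y}"
    have run: "run p x y \<longleftrightarrow> (x, y) \<in> M p" for p
      using xy by (simp add: M_def)
    have "measure_pmf.prob (map_pmf M R) ?A = measure_pmf.prob R {p. run p x y \<noteq> f x y}"
      by (simp add: run vimage_def)
    also have "\<dots> \<le> \<delta>"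
      using R xy by (simp add: pub_computes_def)
    finally have p: "measure_pmf.prob (map_pmf M R) ?A \<le> \<delta>" .
    have "filter (\<lambda>t. run (r t) x y \<noteq> f x y) ts = filter (\<lambda>t. t \<in> ?A) ts"
      by (intro filter_cong refl) (simp add: run r)
    then have "real (length (filter (\<lambda>p. run p x y \<noteq> f x y) (map r ts)))
        = real (length (filter (\<lambda>t. t \<in> ?A) ts))"
      by (simp add: filter_map o_def)
    also have "\<dots> \<le> (measure_pmf.prob (map_pmf M R) ?A + \<epsilon>) * real (length ts)"
      by (rule bound)
    also have "\<dots> \<le> (\<delta> + \<epsilon>) * real (length ts)"
      using p by (intro mult_right_mono) auto
    finally show ?thesis by simp
  qed
  moreover have "map r ts \<noteq> []" "set (map r ts) \<subseteq> set_pmf R"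
    using ts(1) r(1) by auto
  ultimately show ?thesis by blast
qed

section \<open>From correlation to \<open>gap_hd\<close>\<close>

lemma gap_hd_eq_SomeI:
  assumes len: "length u = L" "length v = L" and "0 < L" and "0 < \<eta>"
    and corr: "2 * \<eta> * real L \<le> real_of_int (bool_sign b * correlation u v)"
  shows "gap_hd (1/2 - \<eta>) L u v = Some b"
proof -
  let ?d = "hamming_dist u v"
  have "real_of_int (2 * int ?d) = real_of_int (int L - correlation u v)"
    using hamming_dist_conv_correlation[of u v] len by simp
  then have d: "2 * real ?d = real L - real_of_int (correlation u v)" by simp
  have pos: "0 < \<eta> * real L" using assms by simp
  show ?thesis
  proof (cases b)
    case True
    then have "real ?d \<le> (1/2 - \<eta>) * real L"
      using d corr by (simp add: bool_sign_def algebra_simps)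
    then show ?thesis using True by (simp add: gap_hd_def)
  next
    case False
    then have "(1 - (1/2 - \<eta>)) * real L \<le> real ?d"
      using d corr by (simp add: bool_sign_def algebra_simps)
    \<comment> \<open>\<open>gap_hd\<close> tests for small distance first, so that case has to be
      excluded; this uses that \<open>\<eta> * L\<close> is positive.\<close>
    moreover from this have "\<not> real ?d \<le> (1/2 - \<eta>) * real L"
      using pos by (simp add: algebra_simps)
    ultimately show ?thesis using False by (simp add: gap_hd_def)
  qed
qed

text \<open>The gap depends only on the cost bound \<open>k\<close>; the sizes of \<open>X\<close>
  and \<open>Y\<close> can affect only \<open>L\<close>. This allows one \<gamma> for all
  \<open>n\<close>.\<close>

lemma ex_gap_hd_reduction:
  fixes f :: "'x \<Rightarrow> 'y \<Rightarrow> bool"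
  assumes fin: "finite X" "finite Y" and R: "pub_computes (1/3) X Y f R"
    and cost: "\<And>p. p \<in> set_pmf R \<Longrightarrow> cost p \<le> k"
  shows "\<exists>L \<Phi> \<Psi>. 0 < L \<and> \<Phi> \<in> X \<rightarrow> cube L \<and> \<Psi> \<in> Y \<rightarrow> cube L \<and>
    (\<forall>x\<in>X. \<forall>y\<in>Y. gap_hd (1/2 - 1 / (10 * 2 ^ k)) L (\<Phi> x) (\<Psi> y) = Some (f x y))"
proof -
  obtain ps where ps: "ps \<noteq> []" "set ps \<subseteq> set_pmf R"
    and err: "\<And>x y. x \<in> X \<Longrightarrow> y \<in> Y \<Longrightarrow>
      real (length (filter (\<lambda>p. run p x y \<noteq> f x y) ps)) \<le> (1/3 + 1/15) * real (length ps)"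
    using ex_protocol_sample[OF fin R, of "1/15"] by auto
  have "\<forall>p\<in>set ps. \<exists>U V. encodes k p U V"
    using ps(2) cost ex_encodes by blast
  then obtain U V where enc: "\<And>p. p \<in> set ps \<Longrightarrow> encodes k p (U p) (V p)"
    by metis
  define L where "L = length ps * 4 ^ k"
  define \<Phi> where "\<Phi> x = concat (map (\<lambda>p. U p x) ps)" for x
  define \<Psi> where "\<Psi> y = concat (map (\<lambda>p. V p y) ps)" for y
  have "0 < L" using ps(1) by (simp add: L_def)
  have len: "length (\<Phi> x) = L" "length (\<Psi> y) = L" for x y
    unfolding \<Phi>_def \<Psi>_def L_def using enc by (auto intro!: length_concat_const simp: encodes_def)
  have "gap_hd (1/2 - 1 / (10 * 2 ^ k)) L (\<Phi> x) (\<Psi> y) = Some (f x y)" if xy: "x \<in> X" "y \<in> Y" for x y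
  proof (rule gap_hd_eq_SomeI[OF len \<open>0 < L\<close>])
    let ?e = "length (filter (\<lambda>p. run p x y \<noteq> f x y) ps)"
    have "correlation (\<Phi> x) (\<Psi> y) = (\<Sum>p\<leftarrow>ps. correlation (U p x) (V p y))"
      unfolding \<Phi>_def \<Psi>_def using enc by (intro correlation_concat) (simp add: encodes_def)
    also have "\<dots> = (\<Sum>p\<leftarrow>ps. 2 ^ k * bool_sign (run p x y))"
      using enc by (intro arg_cong[where f = sum_list] map_cong refl) (simp add: encodes_def)
    also have "\<dots> = 2 ^ k * (bool_sign (f x y) * (int (length ps) - 2 * int ?e))"
      by (simp add: sum_list_const_mult sum_list_bool_sign[of _ _ "f x y"])
    finally have "bool_sign (f x y) * correlation (\<Phi> x) (\<Psi> y) = 2 ^ k * (int (length ps) - 2 * int ?e)"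
      by (simp add: bool_sign_def)
    then have corr: "real_of_int (bool_sign (f x y) * correlation (\<Phi> x) (\<Psi> y))
        = 2 ^ k * (real (length ps) - 2 * real ?e)"
      by simp
    \<comment> \<open>An error fraction of at most 2/5 leaves \<open>1 - 2 * 2/5 = 1/5\<close> of
      the sample; half of the ratio \<open>2 ^ k / (5 * 4 ^ k)\<close> is the margin
      \<open>1 / (10 * 2 ^ k)\<close>.\<close>
    have "2 * (1 / (10 * 2 ^ k)) * real L = 2 ^ k * (real (length ps) / 5)"
    proof -
      have "(4::real) ^ k = 2 ^ k * 2 ^ k" by (simp flip: power_mult_distrib)
      then show ?thesis by (simp add: L_def)
    qed
    also have "\<dots> \<le> 2 ^ k * (real (length ps) - 2 * real ?e)"
      using err[OF xy] by (intro mult_left_mono) auto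
    finally show "2 * (1 / (10 * 2 ^ k)) * real L
        \<le> real_of_int (bool_sign (f x y) * correlation (\<Phi> x) (\<Psi> y))"
      unfolding corr .
  qed simp
  then show ?thesis
    using \<open>0 < L\<close> len by (intro exI[of _ L] exI[of _ \<Phi>] exI[of _ \<Psi>]) (auto simp: cube_def)
qed

lemma finite_cube: "finite (cube n)"
  using finite_lists_length_eq[of "UNIV :: bool set" n] by (simp add: cube_def)

text \<open>The \<open>LEAST\<close> is attained because some protocol of bounded cost
  exists.\<close>

lemma ex_pub_computes_pub_cc:
  fixes Y :: "'y set"
  assumes "0 \<le> \<epsilon>"
  shows "\<exists>R. pub_computes \<epsilon> (cube n) Y f R \<and> (\<forall>p\<in>set_pmf R. cost p \<le> pub_cc \<epsilon> (cube n) Y f)"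
  unfolding pub_cc_def by (rule LeastI_ex) (rule ex_pub_computes_cube[OF assms])

theorem theoremA2:
  fixes c :: nat
  shows "\<exists>\<gamma>::real. 0 < \<gamma> \<and> \<gamma> < 1/2 \<and>
    (\<forall>P :: nat \<Rightarrow> bool list \<Rightarrow> bool list \<Rightarrow> bool.
      (\<forall>n. pub_cc (1/3) (cube n) (cube n) (P n) \<le> c) \<longrightarrow>
      (\<forall>n. \<exists>L \<Phi> \<Psi>. 0 < L \<and> \<Phi> \<in> cube n \<rightarrow> cube L \<and> \<Psi> \<in> cube n \<rightarrow> cube L \<and>
        (\<forall>x\<in>cube n. \<forall>y\<in>cube n. gap_hd \<gamma> L (\<Phi> x) (\<Psi> y) = Some (P n x y))))"
proof (intro exI[of _ "1/2 - 1 / (10 * 2 ^ c)"] conjI allI impI)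
  \<comment> \<open>The margin is largest at \<open>c = 0\<close>, where it is 1/10, so \<gamma> is
    at least 2/5.\<close>
  have "(1::real) \<le> 2 ^ c" by simp
  then have "1 / (10 * 2 ^ c) \<le> 1 / (10::real)" by (intro divide_left_mono) auto
  then show "(0::real) < 1/2 - 1 / (10 * 2 ^ c)" by linarith
  show "1/2 - 1 / (10 * 2 ^ c) < (1/2::real)" by simp
next
  fix P :: "nat \<Rightarrow> bool list \<Rightarrow> bool list \<Rightarrow> bool" and n
  assume cc: "\<forall>n. pub_cc (1/3) (cube n) (cube n) (P n) \<le> c"
  obtain R where R: "pub_computes (1/3) (cube n) (cube n) (P n) R"
    and "\<forall>p\<in>set_pmf R. cost p \<le> pub_cc (1/3) (cube n) (cube n) (P n)"
    using ex_pub_computes_pub_cc[of "1/3" n "cube n" "P n"] by auto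
  then have "cost p \<le> c" if "p \<in> set_pmf R" for p
    using cc that le_trans by blast
  from ex_gap_hd_reduction[OF finite_cube finite_cube R this]
  show "\<exists>L \<Phi> \<Psi>. 0 < L \<and> \<Phi> \<in> cube n \<rightarrow> cube L \<and> \<Psi> \<in> cube n \<rightarrow> cube L \<and>
      (\<forall>x\<in>cube n. \<forall>y\<in>cube n.
         gap_hd (1/2 - 1 / (10 * 2 ^ c)) L (\<Phi> x) (\<Psi> y) = Some (P n x y))"
    by blast
qed

end
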